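(* Let $t,d,s,T$ be positive integers, and let $a,b,c$ be positive integers with $t\mid a$, $s\mid b$, $d\mid c$. Put $$N=\begin{cases}(d+1)(t+T)-1, & \text{if } s=1,\\ dst+dT+ts-1+T+1, & \text{if } s>1,\end{cases}$$ and let $\mathbb{F}_q$ be a finite field with $N\mid (q-1)$. Let $A\in\mathbb{F}_q^{a\times b}$ and $B\in\mathbb{F}_q^{b\times c}$ be two matrices. Then the root-of-unity scheme (defined in the context) with partition parameters $(t,d,s)$, security parameter $T$ and an $N$-th primitive root of unity $\alpha_N\in\mathbb{F}_q$ securely computes $AB$ with the assistance of $N$ servers (that is, the scheme is decodable and $T$-secure) and has a total communication rate of $$\mathcal{R}=\left(N\left(\frac{b}{cts}+\frac{b}{asd}+\frac{1}{td}\right)\right)^{-1}.$$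
   Context: Setting (secure distributed matrix multiplication): a user holds $A\in\mathbb{F}_q^{a\times b}$ and $B\in\mathbb{F}_q^{b\times c}$ and wants $AB$ with the help of $N$ honest-but-curious servers, any $T$ of which may collude. Grid partition: $A=[A_{i,j}]_{1\le i\le t,\,1\le j\le s}$ with blocks $A_{i,j}\in\mathbb{F}_q^{\frac at\times\frac bs}$, and $B=[B_{i,j}]_{1\le i\le s,\,1\le j\le d}$ with blocks $B_{i,j}\in\mathbb{F}_q^{\frac bs\times\frac cd}$, so that $AB=\left[\sum_{\ell=1}^s A_{i,\ell}B_{\ell,j}\right]_{1\le i\le t,\,1\le j\le d}$. Root-of-unity scheme: the user chooses $R_1,\dots,R_T\in\mathbb{F}_q^{\frac at\times\frac bs}$ and $S_1,\dots,S_T\in\mathbb{F}_q^{\frac bs\times\frac cd}$ independently and uniformly at random (and independently of $A,B$), and forms the Laurent polynomials with matrix coefficients $$f_A(x)=\sum_{i=1}^t\sum_{j=1}^s A_{i,j}\,x^{(i-1)s+j-1}+\sum_{k=1}^T R_k\,x^{ts+k-1},$$ $$f_B(x)=\sum_{i=1}^s\sum_{j=1}^d B_{i,j}\,x^{(1-j)(ts+T)+(1-i)}+\sum_{k=1}^T S_k\,x^{-d(ts+T)-k+1}.$$ For $i=1,\dots,N$ the user uploads $f_A(\alpha_N^i)$ and $f_B(\alpha_N^i)$ to Server $i$, where $\alpha_N$ is an $N$-th primitive root of unity; Server $i$ computes $f_A(\alpha_N^i)f_B(\alpha_N^i)$ and sends this matrix back to the user. Decodable: for all $A,B$ and all values of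 the $R_k,S_k$, the user can recover all blocks $\sum_{\ell=1}^s A_{i,\ell}B_{\ell,j}$ ($1\le i\le t$, $1\le j\le d$), hence $AB$, from the $N$ responses $f_A(\alpha_N^i)f_B(\alpha_N^i)$, $1\le i\le N$; i.e. $AB$ is a function of these $N$ responses. $T$-secure: when $A,B$ are regarded as random matrices, for every set $\mathcal{T}\subseteq\{1,\dots,N\}$ with $|\mathcal{T}|=T$ the uploads to the servers in $\mathcal{T}$ reveal nothing about $A$ and $B$, i.e. the mutual information $I\big(A,B;\,(f_A(\alpha_N^i),f_B(\alpha_N^i))_{i\in\mathcal{T}}\big)$ is $0$. Total communication rate: the number $ac$ of $\mathbb{F}_q$-symbols of $AB$ divided by the total number of $\mathbb{F}_q$-symbols uploaded to and downloaded from all $N$ servers. *)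

theory Defs
  imports
    "HOL-Probability.Probability"
    "Jordan_Normal_Form.Matrix"
begin

text \<open>
  The field with \<open>q\<close> elements is a type of sort \<open>{field,finite}\<close>, so that \<open>q = CARD('a)\<close>.
  Matrices are those of Jordan_Normal_Form, with entries indexed from \<open>0\<close>; blocks, noise terms
  and servers are indexed from \<open>1\<close>.  HOL-Analysis also has a constant named \<open>mat\<close>, hence the
  qualified \<open>Matrix.mat\<close>.
\<close>

definition primitive_root_of_unity :: "nat \<Rightarrow> 'a::field \<Rightarrow> bool" where
  "primitive_root_of_unity n \<alpha> \<longleftrightarrow> n > 0 \<and> \<alpha> ^ n = 1 \<and> (\<forall>k. 0 < k \<and> k < n \<longrightarrow> \<alpha> ^ k \<noteq> 1)"

definition grid_block :: "nat \<Rightarrow> nat \<Rightarrow> 'a mat \<Rightarrow> nat \<Rightarrow> nat \<Rightarrow> 'a mat" where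
  \<comment> \<open>the \<open>(i, j)\<close> block of \<open>M\<close> cut into a grid of \<open>r\<close> block rows and \<open>c\<close> block columns\<close>
  "grid_block r c M i j =
     Matrix.mat (dim_row M div r) (dim_col M div c)
       (\<lambda>(p, q). M $$ ((i - 1) * (dim_row M div r) + p, (j - 1) * (dim_col M div c) + q))"

text \<open>
  The two Laurent polynomials as functions of a point \<open>x\<close>.  Exponents are integers, and
  the sums are taken in the module of matrices of the block format.
\<close>

definition poly_A :: "nat \<Rightarrow> nat \<Rightarrow> nat \<Rightarrow> 'a::field mat \<Rightarrow> (nat \<Rightarrow> 'a mat) \<Rightarrow> 'a \<Rightarrow> 'a mat" where
  "poly_A t s T A R x =
     (let V = module_mat TYPE('a) (dim_row A div t) (dim_col A div s) in
      finsum V (\<lambda>(i, j). x powi ((int i - 1) * int s + int j - 1) \<cdot>\<^sub>m grid_block t s A i j)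
        ({1..t} \<times> {1..s})
      + finsum V (\<lambda>k. x powi (int t * int s + int k - 1) \<cdot>\<^sub>m R k) {1..T})"

definition poly_B ::
  "nat \<Rightarrow> nat \<Rightarrow> nat \<Rightarrow> nat \<Rightarrow> 'a::field mat \<Rightarrow> (nat \<Rightarrow> 'a mat) \<Rightarrow> 'a \<Rightarrow> 'a mat" where
  "poly_B t d s T B S x =
     (let V = module_mat TYPE('a) (dim_row B div s) (dim_col B div d) in
      finsum V
        (\<lambda>(i, j). x powi ((1 - int j) * (int t * int s + int T) + (1 - int i))
                    \<cdot>\<^sub>m grid_block s d B i j)
        ({1..s} \<times> {1..d})
      + finsum V (\<lambda>k. x powi (- int d * (int t * int s + int T) - int k + 1) \<cdot>\<^sub>m S k) {1..T})"

definition upload ::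
  "nat \<Rightarrow> nat \<Rightarrow> nat \<Rightarrow> nat \<Rightarrow> 'a::field \<Rightarrow> 'a mat \<Rightarrow> 'a mat \<Rightarrow> (nat \<Rightarrow> 'a mat) \<Rightarrow> (nat \<Rightarrow> 'a mat)
     \<Rightarrow> nat \<Rightarrow> 'a mat \<times> 'a mat" where
  "upload t d s T \<alpha> A B R S i = (poly_A t s T A R (\<alpha> ^ i), poly_B t d s T B S (\<alpha> ^ i))"

definition response ::
  "nat \<Rightarrow> nat \<Rightarrow> nat \<Rightarrow> nat \<Rightarrow> 'a::field \<Rightarrow> 'a mat \<Rightarrow> 'a mat \<Rightarrow> (nat \<Rightarrow> 'a mat) \<Rightarrow> (nat \<Rightarrow> 'a mat)
     \<Rightarrow> nat \<Rightarrow> 'a mat" where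
  "response t d s T \<alpha> A B R S i = (case upload t d s T \<alpha> A B R S i of (U, V) \<Rightarrow> U * V)"

definition decodable ::
  "nat \<Rightarrow> nat \<Rightarrow> nat \<Rightarrow> nat \<Rightarrow> nat \<Rightarrow> 'a::field \<Rightarrow> nat \<Rightarrow> nat \<Rightarrow> nat \<Rightarrow> bool" where
  "decodable t d s T N \<alpha> a b c \<longleftrightarrow>
     (\<exists>decode :: (nat \<Rightarrow> 'a mat) \<Rightarrow> 'a mat.
        \<forall>A \<in> carrier_mat a b. \<forall>B \<in> carrier_mat b c.
        \<forall>R \<in> {1..T} \<rightarrow> carrier_mat (a div t) (b div s).
        \<forall>S \<in> {1..T} \<rightarrow> carrier_mat (b div s) (c div d).
          decode (\<lambda>i\<in>{1..N}. response t d s T \<alpha> A B R S i) = A * B)"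

text \<open>Finiteness of the matrix space makes \<open>pmf_of_set\<close> below the uniform distribution.\<close>

lemma finite_carrier_mat: "finite (carrier_mat m n :: 'a::finite mat set)"
proof (rule finite_subset)
  let ?I = "{0..<m} \<times> {0..<n}"
  show "carrier_mat m n \<subseteq> Matrix.mat m n ` (?I \<rightarrow>\<^sub>E (UNIV :: 'a set))"
  proof
    fix M :: "'a mat" assume M: "M \<in> carrier_mat m n"
    show "M \<in> Matrix.mat m n ` (?I \<rightarrow>\<^sub>E (UNIV :: 'a set))"
    proof (rule image_eqI)
      show "M = Matrix.mat m n (restrict (($$) M) ?I)"
        using M by (intro eq_matI) auto
    qed simp
  qed
  show "finite (Matrix.mat m n ` (?I \<rightarrow>\<^sub>E (UNIV :: 'a set)))"
    by (intro finite_imageI finite_PiE) auto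
qed

definition noise :: "nat \<Rightarrow> nat \<Rightarrow> nat \<Rightarrow> (nat \<Rightarrow> 'a::{field,finite} mat) pmf" where
  "noise T m n = Pi_pmf {1..T} undefined (\<lambda>_. pmf_of_set (carrier_mat m n))"

text \<open>
  \<open>P\<close> is the joint distribution of the random pair \<open>(A, B)\<close>, which is arbitrary: \<open>A\<close> and \<open>B\<close> may
  be dependent.  As \<open>'a\<close> is finite, \<open>'a mat\<close> is countable, so every set is measurable in the
  product of the two discrete spaces that \<open>mutual_information\<close> forms.  The base \<open>2\<close> of the
  logarithm is irrelevant for vanishing mutual information.
\<close>

definition T_secure ::
  "nat \<Rightarrow> nat \<Rightarrow> nat \<Rightarrow> nat \<Rightarrow> nat \<Rightarrow> 'a::{field,finite} \<Rightarrow> nat \<Rightarrow> nat \<Rightarrow> nat \<Rightarrow> bool" where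
  "T_secure t d s T N \<alpha> a b c \<longleftrightarrow>
     (\<forall>P :: ('a mat \<times> 'a mat) pmf. set_pmf P \<subseteq> carrier_mat a b \<times> carrier_mat b c \<longrightarrow>
        (\<forall>J \<subseteq> {1..N}. card J = T \<longrightarrow>
           prob_space.mutual_information
             (measure_pmf (pair_pmf P (pair_pmf (noise T (a div t) (b div s))
                                                (noise T (b div s) (c div d)))))
             2 (count_space UNIV) (count_space UNIV)
             (\<lambda>((A, B), (R, S)). (A, B))
             (\<lambda>((A, B), (R, S)). \<lambda>i\<in>J. upload t d s T \<alpha> A B R S i) = 0))"

definition num_symbols :: "'a mat \<Rightarrow> nat" where
  "num_symbols M = dim_row M * dim_col M"

definition communication_rate ::
  "nat \<Rightarrow> nat \<Rightarrow> nat \<Rightarrow> nat \<Rightarrow> nat \<Rightarrow> 'a::field \<Rightarrow> 'a mat \<Rightarrow> 'a mat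
     \<Rightarrow> (nat \<Rightarrow> 'a mat) \<Rightarrow> (nat \<Rightarrow> 'a mat) \<Rightarrow> real" where
  "communication_rate t d s T N \<alpha> A B R S =
     real (num_symbols (A * B)) /
     real (\<Sum>i = 1..N.
       (case upload t d s T \<alpha> A B R S i of (U, V) \<Rightarrow> num_symbols U + num_symbols V)
       + num_symbols (response t d s T \<alpha> A B R S i))"

end

theory Submission
  imports Defs
begin

text \<open>
  Put \<open>K = t * s + T\<close>.  The exponents of \<open>f\<^sub>A\<close> are exactly \<open>0, \<dots>, K - 1\<close>, and block \<open>(i, j)\<close> of \<open>A * B\<close>
  is the coefficient of \<open>f\<^sub>A * f\<^sub>B\<close> at \<open>e = (i - 1) * s - (j - 1) * K\<close>.  Every exponent of the
  product differs from \<open>e\<close> by less than \<open>(d + 1) * K - s \<le> N\<close>, so averaging the responses against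
  \<open>x powi (- e)\<close> over the \<open>N\<close>-th roots of unity isolates this coefficient without aliasing; \<open>N\<close> is
  invertible because it divides \<open>q - 1\<close>.

  For security, the noise terms have \<open>T\<close> consecutive exponents, so by interpolation at \<open>T\<close> distinct
  points some translation of the noise turns the uploads for \<open>(A, B)\<close> into those for any other pair
  \<open>(A', B')\<close>.  Uniform noise is invariant under translations, hence the law of the uploads does
  not depend on \<open>(A, B)\<close>.
\<close>

section \<open>Algebraic preliminaries: matrix sums, roots of unity, characteristic\<close>

lemma finsum_mat:
  fixes f :: "'b \<Rightarrow> 'a::comm_ring_1 mat"
  assumes "finite F" "f \<in> F \<rightarrow> carrier_mat m n"
  shows finsum_mat_closed: "finsum (module_mat TYPE('a) m n) f F \<in> carrier_mat m n"
    and index_finsum_mat: "i < m \<Longrightarrow> j < n \<Longrightarrow>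
      finsum (module_mat TYPE('a) m n) f F $$ (i, j) = (\<Sum>x\<in>F. f x $$ (i, j))"
proof -
  interpret abelian_group "module_mat TYPE('a) m n" by (rule abelian_group_mat)
  have closed: "finsum (module_mat TYPE('a) m n) f F \<in> carrier_mat m n"
    if "f \<in> F \<rightarrow> carrier_mat m n" for F
    using finsum_closed[of f F] that by (simp add: module_mat_simps)
  then show "finsum (module_mat TYPE('a) m n) f F \<in> carrier_mat m n"
    using assms by blast
  show "finsum (module_mat TYPE('a) m n) f F $$ (i, j) = (\<Sum>x\<in>F. f x $$ (i, j))"
    if "i < m" "j < n"
    using assms
  proof (induction F rule: finite_induct)
    case empty
    then show ?case using that by (simp add: module_mat_simps)
  next
    case (insert x F)
    then have "f \<in> F \<rightarrow> carrier_mat m n" "f x \<in> carrier_mat m n" by auto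
    moreover from this insert.hyps have "finsum (module_mat TYPE('a) m n) f (insert x F)
        = f x + finsum (module_mat TYPE('a) m n) f F"
      using finsum_insert[of F x f] by (simp add: module_mat_simps)
    ultimately show ?case
      using insert.IH insert.hyps that closed[of F] by simp
  qed
qed

text \<open>For \<open>z \<noteq> 0\<close> this is a geometric sum with ratio
  \<open>w = \<alpha> powi z\<close>. Here \<open>w ^ N = 1\<close>, while
  \<open>0 < \<bar>z\<bar> < N\<close> and primitivity force \<open>w \<noteq> 1\<close>, so the sum
  vanishes.\<close>

lemma sum_powers_root_of_unity:
  fixes \<alpha> :: "'a::field"
  assumes prim: "primitive_root_of_unity N \<alpha>" and z: "\<bar>z\<bar> < int N"
  shows "(\<Sum>k = 1..N. (\<alpha> ^ k) powi z) = (if z = 0 then of_nat N else 0)"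
proof (cases "z = 0")
  case False
  define w where "w = \<alpha> powi z"
  have N: "N > 0" and \<alpha>N: "\<alpha> ^ N = 1"
    and less: "\<And>k. 0 < k \<Longrightarrow> k < N \<Longrightarrow> \<alpha> ^ k \<noteq> 1"
    using prim by (auto simp: primitive_root_of_unity_def)
  have pow: "(\<alpha> ^ k) powi z = w ^ k" for k
    by (simp add: w_def power_int_power power_int_power' mult.commute)
  have "w ^ N = 1"
    by (metis \<alpha>N pow power_int_1_left)
  moreover have "w \<noteq> 1"
  proof (cases "z > 0")
    case True
    with z show ?thesis using less[of "nat z"] by (auto simp: w_def power_int_def)
  next
    case f: False
    with z False show ?thesis
      using less[of "nat (- z)"] by (auto simp: w_def power_int_def power_inverse)
  qed
  moreover have "(\<Sum>k = 1..N. w ^ k) = w * (\<Sum>k<N. w ^ k)"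
    unfolding sum_distrib_left
    by (rule sum.reindex_bij_witness[of _ Suc "\<lambda>k. k - 1"]) (auto simp flip: power_Suc)
  ultimately show ?thesis
    using False by (simp add: pow geometric_sum)
qed simp

text \<open>Translation by \<open>1\<close> permutes the field, so the sum of all elements is
  unchanged when \<open>1\<close> is added to each summand.\<close>

lemma of_nat_card_eq_0: "of_nat CARD('a) = (0 :: 'a::{field,finite})"
proof -
  have "(\<Sum>x\<in>UNIV. x) = (\<Sum>x\<in>UNIV. x + (1 :: 'a))"
    by (rule sum.reindex_bij_witness[of _ "\<lambda>x. x + 1" "\<lambda>x. x - 1"]) auto
  then show ?thesis
    by (simp add: sum.distrib)
qed

text \<open>If \<open>N\<close> were zero in the field, \<open>CARD('a) = N * m + 1\<close> would be
  \<open>1\<close> there, but it is \<open>0\<close>. Decoding divides by \<open>N\<close>.\<close>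

lemma of_nat_dvd_card_minus_1_neq_0:
  assumes "N dvd CARD('a::{field,finite}) - 1"
  shows "of_nat N \<noteq> (0 :: 'a)"
proof
  assume "of_nat N = (0 :: 'a)"
  moreover obtain m where "CARD('a) - 1 = N * m" using assms by blast
  then have "CARD('a) = N * m + 1" by (metis Suc_eq_plus1 Suc_pred' zero_less_card_finite)
  then have "of_nat CARD('a) = (of_nat N * of_nat m + 1 :: 'a)"
    by (metis of_nat_1 of_nat_add of_nat_mult)
  ultimately show False by (simp add: of_nat_card_eq_0)
qed

section \<open>Interpolation at distinct points\<close>

text \<open>Newton interpolation: a new point is met by adding a multiple of the polynomial
  \<open>r\<close> that vanishes at the old ones. The degree bound is phrased by vanishing
  coefficients so that it also makes sense for empty \<open>X\<close>, where
  \<open>p = 0\<close>.\<close>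

lemma ex_interpolating_poly:
  fixes f :: "'a::field \<Rightarrow> 'a"
  assumes "finite X"
  shows "\<exists>p. (\<forall>i\<ge>card X. coeff p i = 0) \<and> (\<forall>x\<in>X. poly p x = f x)"
  using assms
proof (induction X rule: finite_induct)
  case empty
  show ?case by (intro exI[of _ 0]) simp
next
  case (insert x X)
  then obtain p where p: "\<forall>i\<ge>card X. coeff p i = 0" "\<forall>y\<in>X. poly p y = f y" by blast
  define r where "r = (\<Prod>y\<in>X. [:- y, 1:])"
  have deg: "Polynomial.degree r = card X"
    unfolding r_def by (subst degree_prod_eq_sum_degree) auto
  have rx: "poly r x \<noteq> 0" and rX: "\<And>y. y \<in> X \<Longrightarrow> poly r y = 0"
    using insert.hyps by (auto simp: r_def poly_prod)
  let ?q = "p + Polynomial.smult ((f x - poly p x) / poly r x) r"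
  have "\<forall>i\<ge>card (insert x X). coeff ?q i = 0"
    using p(1) deg insert.hyps by (auto simp: coeff_eq_0)
  moreover have "\<forall>y\<in>insert x X. poly ?q y = f y"
    using rx rX p(2) by auto
  ultimately show ?case by blast
qed

text \<open>Solvability of a Vandermonde system whose rows carry nonzero weights \<open>w i\<close>.
  Dividing by the weights turns it into interpolation of \<open>v i / w i\<close> at the nodes
  \<open>z i\<close>.\<close>

lemma ex_interpolating_coeffs:
  fixes z w v :: "nat \<Rightarrow> 'a::field"
  assumes "finite J" "inj_on z J" "card J = T" "\<And>i. i \<in> J \<Longrightarrow> w i \<noteq> 0"
  shows "\<exists>r. \<forall>i\<in>J. (\<Sum>k = 1..T. w i * z i ^ (k - 1) * r k) = v i"
proof -
  obtain p where p: "\<And>i. i \<ge> T \<Longrightarrow> coeff p i = 0"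
      "\<And>x. x \<in> z ` J \<Longrightarrow> poly p x = v (the_inv_into J z x) / w (the_inv_into J z x)"
    using ex_interpolating_poly[of "z ` J" "\<lambda>x. v (the_inv_into J z x) / w (the_inv_into J z x)"]
      assms by (auto simp: card_image)
  have "(\<Sum>k = 1..T. w i * z i ^ (k - 1) * coeff p (k - 1)) = v i" if i: "i \<in> J" for i
  proof -
    have "(\<Sum>k = 1..T. w i * z i ^ (k - 1) * coeff p (k - 1))
        = w i * (\<Sum>k<T. coeff p k * z i ^ k)"
      unfolding sum_distrib_left
      by (rule sum.reindex_bij_witness[of _ Suc "\<lambda>k. k - 1"]) auto
    also have "(\<Sum>k<T. coeff p k * z i ^ k) = poly p (z i)"
      unfolding poly_altdef
    \<comment> \<open>Either range can be the longer one: \<open>{..<T}\<close> may pass the degree,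
      whereas for \<open>T = 0\<close> it is empty and \<open>{..degree p}\<close> is not. The
      surplus coefficients are zero in both cases.\<close>
    proof (rule sum.mono_neutral_cong)
      show "coeff p k * z i ^ k = 0" if "k \<in> {..Polynomial.degree p} - {..<T}" for k
        using p(1)[of k] that by simp
      show "coeff p k * z i ^ k = 0" if "k \<in> {..<T} - {..Polynomial.degree p}" for k
        using that by (simp add: coeff_eq_0)
    qed auto
    also have "poly p (z i) = v i / w i"
      using p(2)[OF imageI[OF i]] unfolding the_inv_into_f_f[OF assms(2) i] .
    also have "w i * (v i / w i) = v i"
      by (metis assms(4) i nonzero_mult_div_cancel_left times_divide_eq_right)
    finally show ?thesis .
  qed
  then show ?thesis by (intro exI[of _ "\<lambda>k. coeff p (k - 1)"] ballI)
qed

section \<open>Mutual information of discrete distributions\<close>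

text \<open>\<open>pair_pmf\<close> lives on the full power set, the product measure on a possibly
  coarser sigma-algebra; pushing along the identity reconciles them. Agreement on rectangles
  suffices.\<close>

lemma pair_measure_pmf_eq_distr:
  "measure_pmf P \<Otimes>\<^sub>M measure_pmf D =
    distr (measure_pmf (pair_pmf P D)) (count_space UNIV \<Otimes>\<^sub>M count_space UNIV) (\<lambda>x. x)"
    (is "_ = distr ?M ?S _")
proof (rule pair_measure_eqI)
  have meas: "(\<lambda>x. x) \<in> measurable ?M ?S" by (simp add: space_pair_measure)
  show "sets (measure_pmf P \<Otimes>\<^sub>M measure_pmf D) = sets (distr ?M ?S (\<lambda>x. x))"
    by (auto intro!: sets_pair_measure_cong)
  fix A B assume "A \<in> sets (measure_pmf P)" "B \<in> sets (measure_pmf D)"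
  have "emeasure (distr ?M ?S (\<lambda>x. x)) (A \<times> B) = emeasure ?M (A \<times> B)"
    using meas by (subst emeasure_distr) (auto intro: pair_measureI)
  also have "\<dots> = (\<integral>\<^sup>+a. \<integral>\<^sup>+b. indicator A a * indicator B b \<partial>D \<partial>P)"
    by (subst nn_integral_indicator[symmetric])
      (auto simp: nn_integral_pair_pmf' indicator_times)
  also have "\<dots> = emeasure P A * emeasure D B"
    by (simp add: nn_integral_cmult nn_integral_multc)
  finally show "emeasure P A * emeasure D B = emeasure (distr ?M ?S (\<lambda>x. x)) (A \<times> B)" by simp
qed unfold_locales

text \<open>If the conditional law of the second variable is the same \<open>D\<close> for every
  \<open>x\<close> in the support, the joint law is \<open>pair_pmf P D\<close>, the product of its
  marginals. The mutual information is then the divergence of a measure from itself.\<close>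

lemma mutual_information_pair_pmf_eq_0:
  fixes f :: "'b \<Rightarrow> 'c \<Rightarrow> 'd"
  assumes "\<And>x. x \<in> set_pmf P \<Longrightarrow> map_pmf (f x) Q = D"
  shows "prob_space.mutual_information (measure_pmf (pair_pmf P Q)) b
           (count_space UNIV) (count_space UNIV) fst (\<lambda>(x, y). f x y) = 0"
proof -
  let ?M = "measure_pmf (pair_pmf P Q)" and ?C = "count_space UNIV"
  have "map_pmf (\<lambda>(x, y). (x, f x y)) (pair_pmf P Q)
      = bind_pmf P (\<lambda>x. map_pmf (Pair x) (map_pmf (f x) Q))"
    by (simp add: pair_pmf_def map_pmf_def bind_assoc_pmf bind_return_pmf)
  also have "\<dots> = bind_pmf P (\<lambda>x. map_pmf (Pair x) D)"
    using assms by (intro bind_pmf_cong) auto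
  also have "\<dots> = pair_pmf P D"
    by (simp add: pair_pmf_def map_pmf_def)
  finally have joint: "map_pmf (\<lambda>(x, y). (x, f x y)) (pair_pmf P Q) = pair_pmf P D" .
  have D: "map_pmf (\<lambda>(x, y). f x y) (pair_pmf P Q) = D"
    using arg_cong[OF joint, of "map_pmf snd"]
    by (simp add: map_pmf_comp map_snd_pair_pmf case_prod_unfold)
  have "distr ?M ?C fst \<Otimes>\<^sub>M distr ?M ?C (\<lambda>(x, y). f x y) = measure_pmf P \<Otimes>\<^sub>M measure_pmf D"
    by (simp add: map_fst_pair_pmf D flip: map_pmf_rep_eq)
  also have "\<dots> = distr (distr ?M ?C (\<lambda>(x, y). (x, f x y))) (?C \<Otimes>\<^sub>M ?C) (\<lambda>x. x)"
    by (simp add: pair_measure_pmf_eq_distr flip: joint map_pmf_rep_eq)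
  also have "\<dots> = distr ?M (?C \<Otimes>\<^sub>M ?C) (\<lambda>z. (fst z, case z of (x, y) \<Rightarrow> f x y))"
    by (subst distr_distr) (auto simp: o_def case_prod_beta space_pair_measure)
  finally have eq: "distr ?M ?C fst \<Otimes>\<^sub>M distr ?M ?C (\<lambda>(x, y). f x y)
      = distr ?M (?C \<Otimes>\<^sub>M ?C) (\<lambda>z. (fst z, case z of (x, y) \<Rightarrow> f x y))" .
  interpret prob_space "distr ?M (?C \<Otimes>\<^sub>M ?C) (\<lambda>z. (fst z, case z of (x, y) \<Rightarrow> f x y))"
    by (rule measure_pmf.prob_space_distr) (simp add: space_pair_measure)
  show ?thesis
    unfolding prob_space.mutual_information_def[OF prob_space_measure_pmf] eq by (rule KL_same_eq_0)
qed

section \<open>Grid blocks and the two Laurent polynomials, entry by entry\<close>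

lemma grid_block_carrier [simp]:
  "M \<in> carrier_mat m n \<Longrightarrow> grid_block r c M i j \<in> carrier_mat (m div r) (n div c)"
  by (auto simp: grid_block_def)

lemma index_grid_block:
  "M \<in> carrier_mat m n \<Longrightarrow> p < m div r \<Longrightarrow> q < n div c \<Longrightarrow>
    grid_block r c M i j $$ (p, q) = M $$ ((i - 1) * (m div r) + p, (j - 1) * (n div c) + q)"
  by (auto simp: grid_block_def)

text \<open>
  A term of either polynomial is addressed by \<open>Inl (i, j)\<close> for a data block and by \<open>Inr k\<close> for a
  noise block.
\<close>

definition exponent_A :: "nat \<Rightarrow> nat \<Rightarrow> (nat \<times> nat) + nat \<Rightarrow> int" where
  "exponent_A t s = case_sum (\<lambda>(i, j). (int i - 1) * int s + int j - 1)
     (\<lambda>k. int t * int s + int k - 1)"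

definition exponent_B :: "nat \<Rightarrow> nat \<Rightarrow> nat \<Rightarrow> nat \<Rightarrow> (nat \<times> nat) + nat \<Rightarrow> int" where
  "exponent_B t d s T = case_sum
     (\<lambda>(i, j). (1 - int j) * (int t * int s + int T) + (1 - int i))
     (\<lambda>k. - int d * (int t * int s + int T) - int k + 1)"

definition block_coeff ::
  "nat \<Rightarrow> nat \<Rightarrow> 'a mat \<Rightarrow> (nat \<Rightarrow> 'a mat) \<Rightarrow> (nat \<times> nat) + nat \<Rightarrow> 'a mat" where
  "block_coeff r c M R = case_sum (\<lambda>(i, j). grid_block r c M i j) R"

text \<open>Data and noise terms are merged into one sum over a disjoint union, so that the product
  of both polynomials later expands into a single double sum.\<close>

lemma poly_A:
  fixes A :: "'a::field mat"
  assumes A: "A \<in> carrier_mat a b" and R: "R \<in> {1..T} \<rightarrow> carrier_mat (a div t) (b div s)"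
  shows poly_A_carrier: "poly_A t s T A R x \<in> carrier_mat (a div t) (b div s)" (is ?carrier)
    and index_poly_A: "p < a div t \<Longrightarrow> q < b div s \<Longrightarrow> poly_A t s T A R x $$ (p, q) =
      (\<Sum>u\<in>({1..t} \<times> {1..s}) <+> {1..T}. x powi exponent_A t s u * block_coeff t s A R u $$ (p, q))"
      (is "_ \<Longrightarrow> _ \<Longrightarrow> ?index")
proof -
  let ?m = "a div t" and ?n = "b div s"
  let ?f = "\<lambda>(i, j). x powi ((int i - 1) * int s + int j - 1) \<cdot>\<^sub>m grid_block t s A i j"
    and ?g = "\<lambda>k. x powi (int t * int s + int k - 1) \<cdot>\<^sub>m R k"
  have f: "?f \<in> {1..t} \<times> {1..s} \<rightarrow> carrier_mat ?m ?n" and g: "?g \<in> {1..T} \<rightarrow> carrier_mat ?m ?n"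
    using A R by (auto simp: Pi_iff)
  have eq: "poly_A t s T A R x = finsum (module_mat TYPE('a) ?m ?n) ?f ({1..t} \<times> {1..s})
      + finsum (module_mat TYPE('a) ?m ?n) ?g {1..T}"
    using A by (simp add: poly_A_def Let_def)
  note closed = finsum_mat_closed[OF _ f] finsum_mat_closed[OF _ g]
  show ?carrier
    unfolding eq using closed by simp
  show ?index if "p < ?m" "q < ?n"
  proof -
    have dims: "dim_row (grid_block t s A i j) = ?m" "dim_col (grid_block t s A i j) = ?n" for i j
      using grid_block_carrier[OF A, of t s i j] by blast+
    have dimsR: "dim_row (R k) = ?m" "dim_col (R k) = ?n" if "k \<in> {1..T}" for k
      using that R by auto
    have "finsum (module_mat TYPE('a) ?m ?n) ?f ({1..t} \<times> {1..s}) $$ (p, q)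
        = (\<Sum>ij\<in>{1..t} \<times> {1..s}. x powi exponent_A t s (Inl ij) * block_coeff t s A R (Inl ij) $$ (p, q))"
      unfolding index_finsum_mat[OF finite_cartesian_product[OF finite_atLeastAtMost finite_atLeastAtMost] f that]
      using that by (intro sum.cong) (auto simp: dims exponent_A_def block_coeff_def)
    moreover have "finsum (module_mat TYPE('a) ?m ?n) ?g {1..T} $$ (p, q)
        = (\<Sum>k\<in>{1..T}. x powi exponent_A t s (Inr k) * block_coeff t s A R (Inr k) $$ (p, q))"
      unfolding index_finsum_mat[OF finite_atLeastAtMost g that]
      using that by (intro sum.cong) (simp_all add: dimsR exponent_A_def block_coeff_def)
    ultimately show ?thesis
      unfolding eq using that closed(2) by (simp add: sum.Plus)
  qed
qed

lemma poly_B: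
  fixes B :: "'a::field mat"
  assumes B: "B \<in> carrier_mat b c" and S: "S \<in> {1..T} \<rightarrow> carrier_mat (b div s) (c div d)"
  shows poly_B_carrier: "poly_B t d s T B S x \<in> carrier_mat (b div s) (c div d)" (is ?carrier)
    and index_poly_B: "p < b div s \<Longrightarrow> q < c div d \<Longrightarrow> poly_B t d s T B S x $$ (p, q) =
      (\<Sum>u\<in>({1..s} \<times> {1..d}) <+> {1..T}. x powi exponent_B t d s T u * block_coeff s d B S u $$ (p, q))"
      (is "_ \<Longrightarrow> _ \<Longrightarrow> ?index")
proof -
  let ?m = "b div s" and ?n = "c div d"
  let ?f = "\<lambda>(i, j). x powi ((1 - int j) * (int t * int s + int T) + (1 - int i))
      \<cdot>\<^sub>m grid_block s d B i j"
    and ?g = "\<lambda>k. x powi (- int d * (int t * int s + int T) - int k + 1) \<cdot>\<^sub>m S k"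
  have f: "?f \<in> {1..s} \<times> {1..d} \<rightarrow> carrier_mat ?m ?n" and g: "?g \<in> {1..T} \<rightarrow> carrier_mat ?m ?n"
    using B S by (auto simp: Pi_iff)
  have eq: "poly_B t d s T B S x = finsum (module_mat TYPE('a) ?m ?n) ?f ({1..s} \<times> {1..d})
      + finsum (module_mat TYPE('a) ?m ?n) ?g {1..T}"
    using B by (simp add: poly_B_def Let_def)
  note closed = finsum_mat_closed[OF _ f] finsum_mat_closed[OF _ g]
  show ?carrier
    unfolding eq using closed by simp
  show ?index if "p < ?m" "q < ?n"
  proof -
    have dims: "dim_row (grid_block s d B i j) = ?m" "dim_col (grid_block s d B i j) = ?n" for i j
      using grid_block_carrier[OF B, of s d i j] by blast+
    have dimsS: "dim_row (S k) = ?m" "dim_col (S k) = ?n" if "k \<in> {1..T}" for k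
      using that S by auto
    have "finsum (module_mat TYPE('a) ?m ?n) ?f ({1..s} \<times> {1..d}) $$ (p, q)
        = (\<Sum>ij\<in>{1..s} \<times> {1..d}. x powi exponent_B t d s T (Inl ij) * block_coeff s d B S (Inl ij) $$ (p, q))"
      unfolding index_finsum_mat[OF finite_cartesian_product[OF finite_atLeastAtMost finite_atLeastAtMost] f that]
      using that by (intro sum.cong) (auto simp: dims exponent_B_def block_coeff_def)
    moreover have "finsum (module_mat TYPE('a) ?m ?n) ?g {1..T} $$ (p, q)
        = (\<Sum>k\<in>{1..T}. x powi exponent_B t d s T (Inr k) * block_coeff s d B S (Inr k) $$ (p, q))"
      unfolding index_finsum_mat[OF finite_atLeastAtMost g that]
      using that by (intro sum.cong) (simp_all add: dimsS exponent_B_def block_coeff_def)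
    ultimately show ?thesis
      unfolding eq using that closed(2) by (simp add: sum.Plus)
  qed
qed

section \<open>Arithmetic of the exponents\<close>

text \<open>The exponent at which all products of block \<open>(i, l)\<close> of \<open>A\<close>
  with block \<open>(l, j)\<close> of \<open>B\<close> meet: the contributions \<open>l - 1\<close>
  and \<open>1 - l\<close> cancel.\<close>

definition output_exponent :: "nat \<Rightarrow> nat \<Rightarrow> nat \<Rightarrow> nat \<Rightarrow> nat \<Rightarrow> int" where
  "output_exponent t s T i j = (int i - 1) * int s - (int j - 1) * (int t * int s + int T)"

lemma block_row_bounds:
  assumes "i \<in> {1..t}"
  shows "0 \<le> (int i - 1) * int s" "(int i - 1) * int s + int s \<le> int t * int s"
proof -
  show "0 \<le> (int i - 1) * int s" using assms by (intro mult_nonneg_nonneg) auto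
  have "int i * int s \<le> int t * int s" using assms by (intro mult_right_mono) auto
  then show "(int i - 1) * int s + int s \<le> int t * int s" by (simp add: left_diff_distrib)
qed

lemma exponent_A_bounds:
  assumes "u \<in> ({1..t} \<times> {1..s}) <+> {1..T}"
  shows "0 \<le> exponent_A t s u" "exponent_A t s u < int t * int s + int T"
proof -
  have "0 \<le> exponent_A t s u \<and> exponent_A t s u < int t * int s + int T"
    using assms
  proof (elim PlusE SigmaE)
    fix ij i j assume "u = Inl ij" "i \<in> {1..t}" "j \<in> {1..s}" "ij = (i, j)"
    moreover from this have "exponent_A t s u = (int i - 1) * int s + int j - 1"
      by (simp add: exponent_A_def)
    moreover from calculation have "1 \<le> int j" "int j \<le> int s" by auto
    ultimately show ?thesis
      using block_row_bounds[of i t s] by linarith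
  next
    fix k assume "u = Inr k" "k \<in> {1..T}"
    moreover have "0 \<le> int t * int s" by simp
    ultimately show ?thesis by (auto simp: exponent_A_def simp del: mult_nonneg_nonneg)
  qed
  then show "0 \<le> exponent_A t s u" "exponent_A t s u < int t * int s + int T" by auto
qed

text \<open>
  Multiples of \<open>K = t * s + T\<close> separate the block columns of \<open>B\<close>: all remaining differences of
  exponents are smaller than \<open>K\<close> in absolute value.
\<close>

lemma exponent_sum_eq_output:
  assumes u: "u \<in> ({1..t} \<times> {1..s}) <+> {1..T}" and v: "v \<in> ({1..s} \<times> {1..d}) <+> {1..T}"
    and ij: "i \<in> {1..t}" "j \<in> {1..d}"
  shows "exponent_A t s u + exponent_B t d s T v = output_exponent t s T i j \<longleftrightarrow>
    (\<exists>l\<in>{1..s}. u = Inl (i, l) \<and> v = Inl (l, j))" (is "?L \<longleftrightarrow> ?R")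
proof
  assume ?R then show ?L
    by (auto simp: exponent_A_def exponent_B_def output_exponent_def algebra_simps)
next
  assume L: ?L
  define K where "K = int t * int s + int T"
  have bu: "0 \<le> exponent_A t s u" "exponent_A t s u < K"
    using exponent_A_bounds[OF u] by (auto simp: K_def)
  have i0: "0 \<le> (int i - 1) * int s" "(int i - 1) * int s + int s \<le> int t * int s"
    using block_row_bounds[OF ij(1)] by auto
  show ?R
  proof (cases v)
    case (Inr k)
    then have k: "1 \<le> k" using v by auto
    \<comment> \<open>As \<open>j \<le> d\<close>, the last summand is at least \<open>K\<close>,
      which no exponent of \<open>f\<^sub>A\<close> reaches. So noise of \<open>B\<close> never
      meets an output exponent.\<close>
    have "exponent_A t s u = (int i - 1) * int s + (int k - 1) + (int d - int j + 1) * K"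
      using L Inr by (simp add: exponent_B_def output_exponent_def K_def algebra_simps)
    moreover have "K * 1 \<le> K * (int d - int j + 1)"
      using ij bu by (intro mult_left_mono) auto
    ultimately have False using bu i0 k by (simp only: mult.commute)
    then show ?thesis ..
  next
    case (Inl ij')
    then obtain l j' where v': "v = Inl (l, j')" "l \<in> {1..s}" "j' \<in> {1..d}"
      using v by auto
    have eq: "exponent_A t s u - (int l - 1) - (int i - 1) * int s = (int j' - int j) * K"
      using L v' by (simp add: exponent_B_def output_exponent_def K_def algebra_simps)
    \<comment> \<open>The subtracted part lies between \<open>0\<close> and
      \<open>t * s - 1\<close>, so this is a difference of two numbers in \<open>{0..<K}\<close>.
      Being a multiple of \<open>K\<close>, it must be zero.\<close>
    have "\<bar>exponent_A t s u - (int l - 1) - (int i - 1) * int s\<bar> < K"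
      using bu i0 v' by (auto simp: K_def)
    then have "\<bar>int j' - int j\<bar> * K < 1 * K"
      unfolding eq using bu by (simp add: abs_mult)
    then have j: "j' = j"
      using bu by (subst (asm) mult_less_cancel_right) auto
    with eq have eu: "exponent_A t s u = (int i - 1) * int s + (int l - 1)" by simp
    then have "exponent_A t s u < int t * int s" using i0 v' by auto
    \<comment> \<open>The noise exponents of \<open>f\<^sub>A\<close> start at \<open>t * s\<close>,
      so \<open>u\<close> addresses a data block.\<close>
    then obtain i' l' where u': "u = Inl (i', l')" "i' \<in> {1..t}" "l' \<in> {1..s}"
      using u by (auto simp: exponent_A_def)
    have e: "int i * int s + int l = int i' * int s + int l'"
      using eu u' by (simp add: exponent_A_def algebra_simps)
    \<comment> \<open>Uniqueness of quotient and remainder modulo \<open>s\<close>: a multiple of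
      \<open>s\<close> that is smaller than \<open>s\<close> in absolute value is zero.\<close>
    then have "(int i - int i') * int s = int l' - int l" by (simp add: algebra_simps)
    moreover have "\<bar>int l' - int l\<bar> < int s" using u' v' by auto
    ultimately have "\<bar>int i - int i'\<bar> * int s < 1 * int s"
      by (metis abs_mult abs_of_nat mult_1)
    then have "i' = i" using v' by (subst (asm) mult_less_cancel_right) auto
    with e u' v' j show ?thesis by auto
  qed
qed

text \<open>The largest product exponent \<open>K - 1\<close> against the smallest output exponent
  \<open>-(d - 1) * K\<close> gives \<open>d * K - 1\<close>. The smallest product exponent, at
  least \<open>- d * K - T + 1\<close>, against the largest output exponent
  \<open>(t - 1) * s\<close> gives at least \<open>-((d + 1) * K - s - 1)\<close>. As
  \<open>s \<le> K\<close>, the second case dictates the bound on \<open>N\<close>.\<close>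

lemma exponent_sum_minus_output_bound:
  assumes u: "u \<in> ({1..t} \<times> {1..s}) <+> {1..T}" and v: "v \<in> ({1..s} \<times> {1..d}) <+> {1..T}"
    and ij: "i \<in> {1..t}" "j \<in> {1..d}"
    and N: "int N \<ge> (int d + 1) * (int t * int s + int T) - int s"
  shows "\<bar>exponent_A t s u + exponent_B t d s T v - output_exponent t s T i j\<bar> < int N"
proof -
  define K where "K = int t * int s + int T"
  have bu: "0 \<le> exponent_A t s u" "exponent_A t s u < K"
    using exponent_A_bounds[OF u] by (auto simp: K_def)
  have i0: "0 \<le> (int i - 1) * int s" "(int i - 1) * int s + int s \<le> int t * int s"
    using block_row_bounds[OF ij(1)] by auto
  have "- int d * K - int T + 1 \<le> exponent_B t d s T v \<and> exponent_B t d s T v \<le> 0"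
  proof (cases v)
    case (Inl lj)
    then obtain l j' where v': "v = Inl (l, j')" "l \<in> {1..s}" "j' \<in> {1..d}"
      using v by auto
    \<comment> \<open>From \<open>s \<le> t * s \<le> K\<close>, the lowest data exponent
      \<open>-(d - 1) * K - (s - 1)\<close> does not fall below the noise bound.\<close>
    have "1 * int s \<le> int t * int s" using ij by (intro mult_right_mono) auto
    moreover have "(int j' - 1) * K \<le> (int d - 1) * K" "0 \<le> (int j' - 1) * K"
      using v' bu by (auto intro!: mult_right_mono)
    moreover have "exponent_B t d s T v = - ((int j' - 1) * K) - (int l - 1)"
      using v' by (simp add: exponent_B_def K_def algebra_simps)
    moreover have "1 \<le> int l" "int l \<le> int s" "(int d - 1) * K = int d * K - K"
      using v' by (auto simp: left_diff_distrib)
    ultimately show ?thesis unfolding K_def by linarith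
  next
    case (Inr k)
    then have "1 \<le> k" "k \<le> T" using v by auto
    moreover have "0 \<le> int d * K" using bu by simp
    moreover have "exponent_B t d s T v = - (int d * K) - int k + 1"
      using Inr by (simp add: exponent_B_def K_def)
    ultimately show ?thesis by simp
  qed
  moreover have "(int j - 1) * K \<le> (int d - 1) * K" "0 \<le> (int j - 1) * K"
    using ij bu by (auto intro!: mult_right_mono)
  moreover have "int N \<ge> int d * K + K - int s"
    using N by (simp add: K_def algebra_simps)
  moreover have "output_exponent t s T i j = (int i - 1) * int s - (int j - 1) * K"
    by (simp add: output_exponent_def K_def)
  moreover have "int s \<le> K" "(int d - 1) * K = int d * K - K"
    using i0 by (auto simp: K_def algebra_simps)
  moreover have "K = int t * int s + int T" by (simp add: K_def)
  ultimately show ?thesis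
    using bu i0 unfolding abs_less_iff by linarith
qed

section \<open>Decoding from the responses\<close>

lemma primitive_root_of_unity_nonzero:
  "primitive_root_of_unity N (\<alpha> :: 'a::field) \<Longrightarrow> \<alpha> \<noteq> 0"
  by (auto simp: primitive_root_of_unity_def power_0_left)

text \<open>A collision of \<open>i < j\<close> would give \<open>\<alpha> ^ (j - i) = 1\<close>
  with \<open>0 < j - i < N\<close>. This makes the evaluation points of the servers
  distinct.\<close>

lemma primitive_root_of_unity_inj:
  fixes \<alpha> :: "'a::field"
  assumes prim: "primitive_root_of_unity N \<alpha>"
  shows "inj_on (\<lambda>i. \<alpha> ^ i) {1..N}"
proof (rule linorder_inj_onI)
  fix i j assume ij: "i < j" "i \<in> {1..N}" "j \<in> {1..N}"
  show "\<alpha> ^ i \<noteq> \<alpha> ^ j"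
  proof
    assume "\<alpha> ^ i = \<alpha> ^ j"
    also have "\<alpha> ^ j = \<alpha> ^ i * \<alpha> ^ (j - i)" using ij by (simp flip: power_add)
    finally have "\<alpha> ^ (j - i) = 1"
      using primitive_root_of_unity_nonzero[OF prim] by simp
    then show False using prim ij by (auto simp: primitive_root_of_unity_def)
  qed
qed auto

lemma div_pos_of_dvd: "t dvd a \<Longrightarrow> p < a \<Longrightarrow> 0 < a div t" for a :: nat
  by (metis dvd_div_eq_0_iff gr_implies_not0 neq0_conv)

lemma upload_carrier:
  assumes "A \<in> carrier_mat a b" "B \<in> carrier_mat b c"
    and "R \<in> {1..T} \<rightarrow> carrier_mat (a div t) (b div s)"
    and "S \<in> {1..T} \<rightarrow> carrier_mat (b div s) (c div d)"
  shows "upload t d s T \<alpha> A B R S i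
    \<in> carrier_mat (a div t) (b div s) \<times> carrier_mat (b div s) (c div d)"
  using poly_A_carrier[OF assms(1,3)] poly_B_carrier[OF assms(2,4)] by (simp add: upload_def)

text \<open>Expanding by pairs of terms leaves the evaluation point only in a power of the summed
  exponents; \<open>\<alpha> \<noteq> 0\<close> allows integer exponents to be added.\<close>

lemma index_response:
  fixes \<alpha> :: "'a::field"
  assumes A: "A \<in> carrier_mat a b" and B: "B \<in> carrier_mat b c"
    and R: "R \<in> {1..T} \<rightarrow> carrier_mat (a div t) (b div s)"
    and S: "S \<in> {1..T} \<rightarrow> carrier_mat (b div s) (c div d)"
    and "\<alpha> \<noteq> 0" "p < a div t" "q < c div d"
  shows "response t d s T \<alpha> A B R S i $$ (p, q) =
    (\<Sum>u\<in>({1..t} \<times> {1..s}) <+> {1..T}. \<Sum>v\<in>({1..s} \<times> {1..d}) <+> {1..T}.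
       (\<alpha> ^ i) powi (exponent_A t s u + exponent_B t d s T v) *
       (\<Sum>m<b div s. block_coeff t s A R u $$ (p, m) * block_coeff s d B S v $$ (m, q)))"
proof -
  let ?U = "poly_A t s T A R (\<alpha> ^ i)" and ?V = "poly_B t d s T B S (\<alpha> ^ i)"
  have U: "?U \<in> carrier_mat (a div t) (b div s)" and V: "?V \<in> carrier_mat (b div s) (c div d)"
    using poly_A_carrier[OF A R] poly_B_carrier[OF B S] by auto
  have "response t d s T \<alpha> A B R S i $$ (p, q) = (\<Sum>m<b div s. ?U $$ (p, m) * ?V $$ (m, q))"
    using U V assms(6,7)
    by (auto simp: response_def upload_def scalar_prod_def atLeast0LessThan intro!: sum.cong)
  also have "\<dots> = (\<Sum>m<b div s.
      (\<Sum>u\<in>({1..t} \<times> {1..s}) <+> {1..T}. (\<alpha> ^ i) powi exponent_A t s u * block_coeff t s A R u $$ (p, m)) *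
      (\<Sum>v\<in>({1..s} \<times> {1..d}) <+> {1..T}. (\<alpha> ^ i) powi exponent_B t d s T v * block_coeff s d B S v $$ (m, q)))"
    using index_poly_A[OF A R assms(6)] index_poly_B[OF B S _ assms(7)] by (intro sum.cong) auto
  also have "\<dots> = (\<Sum>m<b div s. \<Sum>u\<in>({1..t} \<times> {1..s}) <+> {1..T}. \<Sum>v\<in>({1..s} \<times> {1..d}) <+> {1..T}.
       (\<alpha> ^ i) powi (exponent_A t s u + exponent_B t d s T v) *
       (block_coeff t s A R u $$ (p, m) * block_coeff s d B S v $$ (m, q)))"
    unfolding sum_product using \<open>\<alpha> \<noteq> 0\<close>
    by (intro sum.cong refl) (simp add: power_int_add)
  also have "\<dots> = (\<Sum>u\<in>({1..t} \<times> {1..s}) <+> {1..T}. \<Sum>v\<in>({1..s} \<times> {1..d}) <+> {1..T}. \<Sum>m<b div s.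
       (\<alpha> ^ i) powi (exponent_A t s u + exponent_B t d s T v) *
       (block_coeff t s A R u $$ (p, m) * block_coeff s d B S v $$ (m, q)))"
    by (subst sum.swap, intro sum.cong refl, rule sum.swap)
  finally show ?thesis by (simp only: sum_distrib_left)
qed

text \<open>An inverse discrete Fourier transform up to the factor \<open>N\<close>. Summing over
  the servers turns each pair \<open>(u, v)\<close> into a power sum, which vanishes unless the
  exponents add up to the output exponent; the surviving pairs are the matching data blocks.\<close>

lemma sum_responses:
  fixes \<alpha> :: "'a::field"
  assumes A: "A \<in> carrier_mat a b" and B: "B \<in> carrier_mat b c"
    and R: "R \<in> {1..T} \<rightarrow> carrier_mat (a div t) (b div s)"
    and S: "S \<in> {1..T} \<rightarrow> carrier_mat (b div s) (c div d)"
    and prim: "primitive_root_of_unity N \<alpha>" and pq: "p < a div t" "q < c div d"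
    and ij: "i \<in> {1..t}" "j \<in> {1..d}"
    and N: "int N \<ge> (int d + 1) * (int t * int s + int T) - int s"
  shows "(\<Sum>k = 1..N. (\<alpha> ^ k) powi (- output_exponent t s T i j) *
           response t d s T \<alpha> A B R S k $$ (p, q)) =
    of_nat N * (\<Sum>l = 1..s. \<Sum>m<b div s.
      grid_block t s A i l $$ (p, m) * grid_block s d B l j $$ (m, q))"
proof -
  let ?I = "({1..t} \<times> {1..s}) <+> {1..T}" and ?J = "({1..s} \<times> {1..d}) <+> {1..T}"
  define e where "e = output_exponent t s T i j"
  define E where "E u v = exponent_A t s u + exponent_B t d s T v" for u v
  define W where "W u v =
    (\<Sum>m<b div s. block_coeff t s A R u $$ (p, m) * block_coeff s d B S v $$ (m, q))" for u v
  have \<alpha>: "\<alpha> \<noteq> 0" using prim by (rule primitive_root_of_unity_nonzero)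
  have "(\<Sum>k = 1..N. (\<alpha> ^ k) powi (- e) * response t d s T \<alpha> A B R S k $$ (p, q))
      = (\<Sum>k = 1..N. \<Sum>u\<in>?I. \<Sum>v\<in>?J. (\<alpha> ^ k) powi (E u v - e) * W u v)"
    unfolding index_response[OF A B R S \<alpha> pq] E_def[symmetric] W_def[symmetric] sum_distrib_left
    using \<alpha> by (intro sum.cong refl) (simp add: power_int_diff power_int_minus field_simps)
  also have "\<dots> = (\<Sum>u\<in>?I. \<Sum>v\<in>?J. (\<Sum>k = 1..N. (\<alpha> ^ k) powi (E u v - e)) * W u v)"
    unfolding sum_distrib_right by (subst sum.swap, intro sum.cong refl, rule sum.swap)
  also have "\<dots> = (\<Sum>u\<in>?I. \<Sum>v\<in>?J. if E u v = e then of_nat N * W u v else 0)"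
  proof (intro sum.cong refl)
    fix u v assume "u \<in> ?I" "v \<in> ?J"
    then have "\<bar>E u v - e\<bar> < int N"
      unfolding E_def e_def by (rule exponent_sum_minus_output_bound[OF _ _ ij N])
    then show "(\<Sum>k = 1..N. (\<alpha> ^ k) powi (E u v - e)) * W u v = (if E u v = e then of_nat N * W u v else 0)"
      using sum_powers_root_of_unity[OF prim] by auto
  qed
  also have "\<dots> = (\<Sum>(u, v)\<in>?I \<times> ?J. if E u v = e then of_nat N * W u v else 0)"
    by (rule sum.cartesian_product)
  \<comment> \<open>The surviving pairs are the image of \<open>{1..s}\<close> under an injective
    map, so the sum can afterwards be reindexed by \<open>l\<close>.\<close>
  also have "\<dots> = (\<Sum>(u, v)\<in>(\<lambda>l. (Inl (i, l), Inl (l, j))) ` {1..s}. of_nat N * W u v)"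
  proof (rule sum.mono_neutral_cong_right)
    show "(\<lambda>l. (Inl (i, l), Inl (l, j))) ` {1..s} \<subseteq> ?I \<times> ?J" using ij by auto
    have *: "E u v = e \<longleftrightarrow> (u, v) \<in> (\<lambda>l. (Inl (i, l), Inl (l, j))) ` {1..s}"
      if "u \<in> ?I" "v \<in> ?J" for u v
      unfolding E_def e_def exponent_sum_eq_output[OF that ij] by auto
    show "\<forall>z\<in>?I \<times> ?J - (\<lambda>l. (Inl (i, l), Inl (l, j))) ` {1..s}.
        (case z of (u, v) \<Rightarrow> if E u v = e then of_nat N * W u v else 0) = 0"
    proof
      fix z assume z: "z \<in> ?I \<times> ?J - (\<lambda>l. (Inl (i, l), Inl (l, j))) ` {1..s}"
      obtain u v where "z = (u, v)" by (cases z)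
      with z *[of u v] show "(case z of (u, v) \<Rightarrow> if E u v = e then of_nat N * W u v else 0) = 0"
        by simp
    qed
    fix z :: "((nat \<times> nat) + nat) \<times> ((nat \<times> nat) + nat)"
    assume "z \<in> (\<lambda>l. (Inl (i, l), Inl (l, j))) ` {1..s}"
    then obtain l where l: "l \<in> {1..s}" "z = (Inl (i, l), Inl (l, j))" by blast
    moreover from this have "Inl (i, l) \<in> ?I" "Inl (l, j) \<in> ?J"
      using ij by auto
    ultimately have "E (Inl (i, l)) (Inl (l, j)) = e"
      using *[of "Inl (i, l)" "Inl (l, j)"] by blast
    then show "(case z of (u, v) \<Rightarrow> if E u v = e then of_nat N * W u v else 0)
        = (case z of (u, v) \<Rightarrow> of_nat N * W u v)" using l by simp
  qed simp
  also have "\<dots> = (\<Sum>l = 1..s. of_nat N * W (Inl (i, l)) (Inl (l, j)))"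
    by (subst sum.reindex) (auto simp: inj_on_def)
  finally show ?thesis
    by (simp add: e_def W_def block_coeff_def sum_distrib_left)
qed

text \<open>Row \<open>p\<close> has offset \<open>p mod (a div t)\<close> in block row
  \<open>p div (a div t) + 1\<close>, the \<open>+ 1\<close> because blocks count from
  \<open>1\<close> and entries from \<open>0\<close>. The inner index runs over \<open>s\<close>
  consecutive intervals of length \<open>b div s\<close>.\<close>

lemma index_mult_grid_blocks:
  fixes A B :: "'a::comm_ring_1 mat"
  assumes A: "A \<in> carrier_mat a b" and B: "B \<in> carrier_mat b c"
    and dvd: "t dvd a" "s dvd b" "d dvd c" and p: "p < a" and q: "q < c"
  shows "(\<Sum>l = 1..s. \<Sum>m<b div s.
      grid_block t s A (p div (a div t) + 1) l $$ (p mod (a div t), m) *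
      grid_block s d B l (q div (c div d) + 1) $$ (m, q mod (c div d))) = (A * B) $$ (p, q)"
proof -
  let ?n = "b div s"
  have "a div t > 0" "c div d > 0" using div_pos_of_dvd dvd p q by blast+
  then have mod: "p mod (a div t) < a div t" "q mod (c div d) < c div d" by auto
  have "(\<Sum>l = 1..s. \<Sum>m<?n.
      grid_block t s A (p div (a div t) + 1) l $$ (p mod (a div t), m) *
      grid_block s d B l (q div (c div d) + 1) $$ (m, q mod (c div d)))
    = (\<Sum>l = 1..s. \<Sum>m<?n. A $$ (p, (l - 1) * ?n + m) * B $$ ((l - 1) * ?n + m, q))"
    using mod by (intro sum.cong refl) (simp add: index_grid_block[OF A] index_grid_block[OF B] div_mult_mod_eq)
  also have "\<dots> = (\<Sum>l<s. \<Sum>m<?n. A $$ (p, l * ?n + m) * B $$ (l * ?n + m, q))"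
    by (rule sum.reindex_bij_witness[of _ Suc "\<lambda>l. l - 1"]) auto
  also have "\<dots> = (\<Sum>l<s. \<Sum>n = l * ?n..<l * ?n + ?n. A $$ (p, n) * B $$ (n, q))"
  proof (rule sum.cong[OF refl])
    fix l
    show "(\<Sum>m<?n. A $$ (p, l * ?n + m) * B $$ (l * ?n + m, q))
        = (\<Sum>n = l * ?n..<l * ?n + ?n. A $$ (p, n) * B $$ (n, q))"
      by (rule sum.reindex_bij_witness[of _ "\<lambda>n. n - l * ?n" "\<lambda>m. l * ?n + m"]) auto
  qed
  also have "\<dots> = (\<Sum>n<s * ?n. A $$ (p, n) * B $$ (n, q))"
    by (rule sum.nat_group)
  also have "\<dots> = (A * B) $$ (p, q)"
    using A B p q dvd by (auto simp: scalar_prod_def atLeast0LessThan intro!: sum.cong)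
  finally show ?thesis .
qed

lemma decodable_root_of_unity:
  fixes \<alpha> :: "'a::field"
  assumes dvd: "t dvd a" "s dvd b" "d dvd c"
    and N: "int N \<ge> (int d + 1) * (int t * int s + int T) - int s"
    and N0: "of_nat N \<noteq> (0 :: 'a)" and prim: "primitive_root_of_unity N \<alpha>"
  shows "decodable t d s T N \<alpha> a b c"
proof -
  \<comment> \<open>The weights depend only on the block containing entry \<open>(p, q)\<close>, so
    the decoder uses nothing but the responses and public parameters.\<close>
  define decode where "decode Y = Matrix.mat a c (\<lambda>(p, q). inverse (of_nat N) *
    (\<Sum>k = 1..N. (\<alpha> ^ k) powi (- output_exponent t s T (p div (a div t) + 1) (q div (c div d) + 1)) *
       Y k $$ (p mod (a div t), q mod (c div d))))" for Y :: "nat \<Rightarrow> 'a mat"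
  have "decode (\<lambda>i\<in>{1..N}. response t d s T \<alpha> A B R S i) = A * B"
    if A: "A \<in> carrier_mat a b" and B: "B \<in> carrier_mat b c"
      and R: "R \<in> {1..T} \<rightarrow> carrier_mat (a div t) (b div s)"
      and S: "S \<in> {1..T} \<rightarrow> carrier_mat (b div s) (c div d)" for A B R S
  proof (rule eq_matI)
    fix p q assume "p < dim_row (A * B)" "q < dim_col (A * B)"
    then have pq: "p < a" "q < c" using A B by auto
    then have "a div t > 0" "c div d > 0" "a = a div t * t" "c = c div d * d"
      using div_pos_of_dvd dvd by auto
    then have mod: "p mod (a div t) < a div t" "q mod (c div d) < c div d"
      and ij: "p div (a div t) + 1 \<in> {1..t}" "q div (c div d) + 1 \<in> {1..d}"
      using pq by (auto simp: Suc_le_eq less_mult_imp_div_less mult.commute)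
    have "decode (\<lambda>i\<in>{1..N}. response t d s T \<alpha> A B R S i) $$ (p, q) = inverse (of_nat N) *
        (\<Sum>k = 1..N. (\<alpha> ^ k) powi (- output_exponent t s T (p div (a div t) + 1) (q div (c div d) + 1)) *
          response t d s T \<alpha> A B R S k $$ (p mod (a div t), q mod (c div d)))"
      using pq by (simp add: decode_def)
    also have "\<dots> = (A * B) $$ (p, q)"
      unfolding sum_responses[OF A B R S prim mod ij N] index_mult_grid_blocks[OF A B dvd pq]
      using N0 by simp
    finally show "decode (\<lambda>i\<in>{1..N}. response t d s T \<alpha> A B R S i) $$ (p, q) = (A * B) $$ (p, q)" .
  qed (use A B in \<open>auto simp: decode_def\<close>)
  then show ?thesis unfolding decodable_def by (intro exI[of _ decode] ballI)
qed

section \<open>Security against colluding servers\<close>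

text \<open>Each entry is interpolated separately; the coefficients found at the positions
  \<open>(p, q)\<close> are then assembled into matrices.\<close>

lemma ex_interpolating_mats:
  fixes z w :: "nat \<Rightarrow> 'a::field" and V :: "nat \<Rightarrow> nat \<Rightarrow> nat \<Rightarrow> 'a"
  assumes "finite J" "inj_on z J" "card J = T" "\<And>i. i \<in> J \<Longrightarrow> w i \<noteq> 0"
  obtains Q where "\<And>k. Q k \<in> carrier_mat m n"
    and "\<And>i p q. i \<in> J \<Longrightarrow> p < m \<Longrightarrow> q < n \<Longrightarrow>
      (\<Sum>k = 1..T. w i * z i ^ (k - 1) * Q k $$ (p, q)) = V i p q"
proof -
  have "\<forall>p q. \<exists>r. \<forall>i\<in>J. (\<Sum>k = 1..T. w i * z i ^ (k - 1) * r k) = V i p q"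
    by (intro allI ex_interpolating_coeffs assms)
  then obtain r where r: "\<And>p q i. i \<in> J \<Longrightarrow> (\<Sum>k = 1..T. w i * z i ^ (k - 1) * r p q k) = V i p q"
    by metis
  show ?thesis
    by (rule that[of "\<lambda>k. Matrix.mat m n (\<lambda>(p, q). r p q k)"]) (use r in simp_all)
qed

text \<open>Values outside \<open>{1..T}\<close> are kept so that the default
  \<open>undefined\<close> of \<open>noise\<close> survives and the support is mapped to
  itself.\<close>

definition shift_noise :: "nat \<Rightarrow> (nat \<Rightarrow> 'a::ring_1 mat) \<Rightarrow> (nat \<Rightarrow> 'a mat) \<Rightarrow> nat \<Rightarrow> 'a mat" where
  "shift_noise T Q R k = (if k \<in> {1..T} then R k + Q k else R k)"

lemma shift_noise_carrier:
  "(\<And>k. Q k \<in> carrier_mat m n) \<Longrightarrow> R \<in> {1..T} \<rightarrow> carrier_mat m n \<Longrightarrow>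
    shift_noise T Q R \<in> {1..T} \<rightarrow> carrier_mat m n"
  by (auto simp: shift_noise_def Pi_iff)

lemma noise_eq_pmf_of_set:
  "noise T m n = pmf_of_set (PiE_dflt {1..T} undefined (\<lambda>_. carrier_mat m n))"
proof -
  have "0\<^sub>m m n \<in> carrier_mat m n" by simp
  then have "carrier_mat m n \<noteq> ({} :: 'a mat set)" by blast
  then show ?thesis
    unfolding noise_def by (intro Pi_pmf_of_set) (auto simp: finite_carrier_mat)
qed

lemma set_noise: "R \<in> set_pmf (noise T m n) \<Longrightarrow> R \<in> {1..T} \<rightarrow> carrier_mat m n"
proof -
  assume "R \<in> set_pmf (noise T m n)"
  moreover have "0\<^sub>m m n \<in> carrier_mat m n" by simp
  then have "carrier_mat m n \<noteq> ({} :: 'a mat set)" by blast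
  ultimately show "R \<in> {1..T} \<rightarrow> carrier_mat m n"
    by (auto simp: noise_def set_Pi_pmf PiE_dflt_def finite_carrier_mat)
qed

text \<open>Translation by \<open>Q\<close> permutes the support, with translation by
  \<open>- Q k\<close> as inverse, and a bijection preserves the uniform law.\<close>

lemma map_shift_noise:
  fixes Q :: "nat \<Rightarrow> 'a::{field,finite} mat"
  assumes Q: "\<And>k. Q k \<in> carrier_mat m n"
  shows "map_pmf (shift_noise T Q) (noise T m n) = noise T m n"
  unfolding noise_eq_pmf_of_set
proof (rule map_pmf_of_set_bij_betw)
  let ?X = "PiE_dflt {1..T} undefined (\<lambda>_. carrier_mat m n :: 'a mat set)"
  have cancel: "M + Q k + - Q k = M" "M + - Q k + Q k = M" if "M \<in> carrier_mat m n" for M k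
    using that Q[of k] by (auto intro!: eq_matI)
  show "bij_betw (shift_noise T Q) ?X ?X"
    by (rule bij_betwI[where g = "shift_noise T (\<lambda>k. - Q k)"])
      (use Q in \<open>auto simp: shift_noise_def PiE_dflt_def fun_eq_iff cancel\<close>)
  show "finite ?X" by (intro finite_PiE_dflt) (auto simp: finite_carrier_mat)
  show "?X \<noteq> {}" unfolding PiE_dflt_empty_iff by (auto intro: zero_carrier_mat)
qed

text \<open>\<open>Q\<close> has to contribute the difference of the data parts of \<open>A'\<close>
  and \<open>A\<close> at each of the \<open>T\<close> points. This condition does not involve
  \<open>R\<close>, so a single \<open>Q\<close> serves all noise values.\<close>

lemma ex_shift_noise_A:
  fixes x :: "nat \<Rightarrow> 'a::field"
  assumes A: "A \<in> carrier_mat a b" and A': "A' \<in> carrier_mat a b"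
    and J: "finite J" "inj_on x J" "card J = T" and x: "\<And>i. i \<in> J \<Longrightarrow> x i \<noteq> 0"
  obtains Q where "\<And>k. Q k \<in> carrier_mat (a div t) (b div s)"
    and "\<And>R i. R \<in> {1..T} \<rightarrow> carrier_mat (a div t) (b div s) \<Longrightarrow> i \<in> J \<Longrightarrow>
      poly_A t s T A (shift_noise T Q R) (x i) = poly_A t s T A' R (x i)"
proof -
  \<comment> \<open>The data part of the polynomial; on \<open>Inl\<close> indices
    \<open>block_coeff\<close> ignores its noise argument, so \<open>undefined\<close> may stand
    there.\<close>
  define D where "D M i p q = (\<Sum>u\<in>{1..t} \<times> {1..s}.
    x i powi exponent_A t s (Inl u) * block_coeff t s M (\<lambda>_. undefined) (Inl u) $$ (p, q))" for M i p q
  have D: "(\<Sum>u\<in>{1..t} \<times> {1..s}.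
    x i powi exponent_A t s (Inl u) * block_coeff t s M R (Inl u) $$ (p, q)) = D M i p q" for M R i p q
    by (simp add: D_def block_coeff_def)
  obtain Q where Q: "\<And>k. Q k \<in> carrier_mat (a div t) (b div s)"
    and eq: "\<And>i p q. i \<in> J \<Longrightarrow> p < a div t \<Longrightarrow> q < b div s \<Longrightarrow>
      (\<Sum>k = 1..T. x i ^ (t * s) * x i ^ (k - 1) * Q k $$ (p, q)) = D A' i p q - D A i p q"
    by (rule ex_interpolating_mats[OF J, of "\<lambda>i. x i ^ (t * s)" "a div t" "b div s"
          "\<lambda>i p q. D A' i p q - D A i p q"]) (use x in auto)
  have pow: "x i powi exponent_A t s (Inr k) = x i ^ (t * s) * x i ^ (k - 1)" if "k \<in> {1..T}" for i k
  proof -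
    have "exponent_A t s (Inr k) = int (t * s + (k - 1))"
      using that by (auto simp: exponent_A_def of_nat_diff)
    then show ?thesis by (simp only: power_int_of_nat power_add)
  qed
  show ?thesis
  proof (rule that[OF Q])
    fix R :: "nat \<Rightarrow> 'a mat" and i
    assume R: "R \<in> {1..T} \<rightarrow> carrier_mat (a div t) (b div s)" and i: "i \<in> J"
    have SR: "shift_noise T Q R \<in> {1..T} \<rightarrow> carrier_mat (a div t) (b div s)"
      using Q R by (rule shift_noise_carrier)
    show "poly_A t s T A (shift_noise T Q R) (x i) = poly_A t s T A' R (x i)" (is "?L = ?R")
    proof (rule eq_matI)
      fix p q assume "p < dim_row ?R" "q < dim_col ?R"
      then have pq: "p < a div t" "q < b div s" using poly_A_carrier[OF A' R, where x = "x i"] by auto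
      have "(\<Sum>k\<in>{1..T}. x i powi exponent_A t s (Inr k) * block_coeff t s A (shift_noise T Q R) (Inr k) $$ (p, q))
        = (\<Sum>k\<in>{1..T}. x i powi exponent_A t s (Inr k) * block_coeff t s A' R (Inr k) $$ (p, q)
            + x i ^ (t * s) * x i ^ (k - 1) * Q k $$ (p, q))"
      proof (intro sum.cong refl)
        fix k assume k: "k \<in> {1..T}"
        have "shift_noise T Q R k $$ (p, q) = R k $$ (p, q) + Q k $$ (p, q)"
          using k pq Q[of k] by (auto simp: shift_noise_def)
        then show "x i powi exponent_A t s (Inr k) * block_coeff t s A (shift_noise T Q R) (Inr k) $$ (p, q)
          = x i powi exponent_A t s (Inr k) * block_coeff t s A' R (Inr k) $$ (p, q)
            + x i ^ (t * s) * x i ^ (k - 1) * Q k $$ (p, q)"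
          unfolding pow[OF k] by (simp add: block_coeff_def distrib_left)
      qed
      also have "\<dots> = (\<Sum>k\<in>{1..T}. x i powi exponent_A t s (Inr k) * block_coeff t s A' R (Inr k) $$ (p, q))
          + (D A' i p q - D A i p q)"
        unfolding sum.distrib eq[OF i pq] ..
      finally show "?L $$ (p, q) = ?R $$ (p, q)"
        unfolding index_poly_A[OF A SR pq] index_poly_A[OF A' R pq]
        by (simp add: sum.Plus D del: One_nat_def)
    qed (use poly_A_carrier[OF A' R, where x = "x i"] poly_A_carrier[OF A SR, where x = "x i"] in \<open>auto\<close>)
  qed
qed

text \<open>The noise exponents of \<open>f\<^sub>B\<close> descend from \<open>- d * K\<close>, so
  the interpolation nodes are the inverses of the evaluation points and the weight is
  \<open>x i powi (- d * K)\<close>.\<close>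

lemma ex_shift_noise_B:
  fixes x :: "nat \<Rightarrow> 'a::field"
  assumes B: "B \<in> carrier_mat b c" and B': "B' \<in> carrier_mat b c"
    and J: "finite J" "inj_on x J" "card J = T" and x: "\<And>i. i \<in> J \<Longrightarrow> x i \<noteq> 0"
  obtains Q where "\<And>k. Q k \<in> carrier_mat (b div s) (c div d)"
    and "\<And>S i. S \<in> {1..T} \<rightarrow> carrier_mat (b div s) (c div d) \<Longrightarrow> i \<in> J \<Longrightarrow>
      poly_B t d s T B (shift_noise T Q S) (x i) = poly_B t d s T B' S (x i)"
proof -
  define D where "D M i p q = (\<Sum>u\<in>{1..s} \<times> {1..d}.
    x i powi exponent_B t d s T (Inl u) * block_coeff s d M (\<lambda>_. undefined) (Inl u) $$ (p, q))" for M i p q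
  have D: "(\<Sum>u\<in>{1..s} \<times> {1..d}.
    x i powi exponent_B t d s T (Inl u) * block_coeff s d M S (Inl u) $$ (p, q)) = D M i p q" for M S i p q
    by (simp add: D_def block_coeff_def)
  define w where "w i = x i powi (- int d * (int t * int s + int T))" for i
  have inj: "inj_on (\<lambda>i. inverse (x i)) J"
    using J(2) by (simp add: inj_on_def)
  obtain Q where Q: "\<And>k. Q k \<in> carrier_mat (b div s) (c div d)"
    and eq: "\<And>i p q. i \<in> J \<Longrightarrow> p < b div s \<Longrightarrow> q < c div d \<Longrightarrow>
      (\<Sum>k = 1..T. w i * inverse (x i) ^ (k - 1) * Q k $$ (p, q)) = D B' i p q - D B i p q"
    by (rule ex_interpolating_mats[OF J(1) inj J(3), of w "b div s" "c div d"
          "\<lambda>i p q. D B' i p q - D B i p q"]) (use x in \<open>auto simp: w_def\<close>)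
  have pow: "x i powi exponent_B t d s T (Inr k) = w i * inverse (x i) ^ (k - 1)"
    if "k \<in> {1..T}" "i \<in> J" for i k
  proof -
    have "exponent_B t d s T (Inr k) = - int d * (int t * int s + int T) + - int (k - 1)"
      using that by (auto simp: exponent_B_def of_nat_diff)
    then show ?thesis
      unfolding w_def by (simp only: power_int_add[OF disjI1[OF x[OF that(2)]]] power_int_minus
          power_int_of_nat power_inverse)
  qed
  show ?thesis
  proof (rule that[OF Q])
    fix S :: "nat \<Rightarrow> 'a mat" and i
    assume S: "S \<in> {1..T} \<rightarrow> carrier_mat (b div s) (c div d)" and i: "i \<in> J"
    have SS: "shift_noise T Q S \<in> {1..T} \<rightarrow> carrier_mat (b div s) (c div d)"
      using Q S by (rule shift_noise_carrier)
    show "poly_B t d s T B (shift_noise T Q S) (x i) = poly_B t d s T B' S (x i)" (is "?L = ?R")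
    proof (rule eq_matI)
      fix p q assume "p < dim_row ?R" "q < dim_col ?R"
      then have pq: "p < b div s" "q < c div d" using poly_B_carrier[OF B' S, where t = t and x = "x i"] by auto
      have "(\<Sum>k\<in>{1..T}. x i powi exponent_B t d s T (Inr k) * block_coeff s d B (shift_noise T Q S) (Inr k) $$ (p, q))
        = (\<Sum>k\<in>{1..T}. x i powi exponent_B t d s T (Inr k) * block_coeff s d B' S (Inr k) $$ (p, q)
            + w i * inverse (x i) ^ (k - 1) * Q k $$ (p, q))"
      proof (intro sum.cong refl)
        fix k assume k: "k \<in> {1..T}"
        have "shift_noise T Q S k $$ (p, q) = S k $$ (p, q) + Q k $$ (p, q)"
          using k pq Q[of k] by (auto simp: shift_noise_def)
        then show "x i powi exponent_B t d s T (Inr k) * block_coeff s d B (shift_noise T Q S) (Inr k) $$ (p, q)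
          = x i powi exponent_B t d s T (Inr k) * block_coeff s d B' S (Inr k) $$ (p, q)
            + w i * inverse (x i) ^ (k - 1) * Q k $$ (p, q)"
          unfolding pow[OF k i] by (simp add: block_coeff_def distrib_left)
      qed
      also have "\<dots> = (\<Sum>k\<in>{1..T}. x i powi exponent_B t d s T (Inr k) * block_coeff s d B' S (Inr k) $$ (p, q))
          + (D B' i p q - D B i p q)"
        unfolding sum.distrib eq[OF i pq] ..
      finally show "?L $$ (p, q) = ?R $$ (p, q)"
        unfolding index_poly_B[OF B SS pq] index_poly_B[OF B' S pq]
        by (simp add: sum.Plus D del: One_nat_def)
    qed (use poly_B_carrier[OF B' S, where t = t and x = "x i"] poly_B_carrier[OF B SS, where t = t and x = "x i"] in \<open>auto\<close>)
  qed
qed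

lemma map_pmf_uploads_eq:
  fixes \<alpha> :: "'a::{field,finite}"
  assumes prim: "primitive_root_of_unity N \<alpha>"
    and A: "A \<in> carrier_mat a b" "A' \<in> carrier_mat a b"
    and B: "B \<in> carrier_mat b c" "B' \<in> carrier_mat b c"
    and J: "J \<subseteq> {1..N}" "card J = T"
  shows "map_pmf (\<lambda>(R, S). \<lambda>i\<in>J. upload t d s T \<alpha> A B R S i)
      (pair_pmf (noise T (a div t) (b div s)) (noise T (b div s) (c div d))) =
    map_pmf (\<lambda>(R, S). \<lambda>i\<in>J. upload t d s T \<alpha> A' B' R S i)
      (pair_pmf (noise T (a div t) (b div s)) (noise T (b div s) (c div d)))"
    (is "map_pmf ?U ?noises = map_pmf ?U' ?noises")
proof -
  have fin: "finite J" and inj: "inj_on (\<lambda>i. \<alpha> ^ i) J"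
    using J primitive_root_of_unity_inj[OF prim] finite_subset inj_on_subset by blast+
  have nz: "\<alpha> ^ i \<noteq> 0" for i using primitive_root_of_unity_nonzero[OF prim] by simp
  obtain Q where Q: "\<And>k. Q k \<in> carrier_mat (a div t) (b div s)"
    "\<And>R i. R \<in> {1..T} \<rightarrow> carrier_mat (a div t) (b div s) \<Longrightarrow> i \<in> J \<Longrightarrow>
      poly_A t s T A (shift_noise T Q R) (\<alpha> ^ i) = poly_A t s T A' R (\<alpha> ^ i)"
    using ex_shift_noise_A[OF A fin inj J(2) nz] by blast
  obtain Q' where Q': "\<And>k. Q' k \<in> carrier_mat (b div s) (c div d)"
    "\<And>S i. S \<in> {1..T} \<rightarrow> carrier_mat (b div s) (c div d) \<Longrightarrow> i \<in> J \<Longrightarrow>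
      poly_B t d s T B (shift_noise T Q' S) (\<alpha> ^ i) = poly_B t d s T B' S (\<alpha> ^ i)"
    using ex_shift_noise_B[OF B fin inj J(2) nz] by blast
  \<comment> \<open>Both noise families are independent and each is invariant under its translation,
    so the translation can be inserted without changing the law.\<close>
  have "map_pmf ?U ?noises = map_pmf ?U
      (map_pmf (\<lambda>(R, S). (shift_noise T Q R, shift_noise T Q' S)) ?noises)"
    by (simp add: map_pair map_shift_noise Q(1) Q'(1))
  also have "\<dots> = map_pmf ?U' ?noises"
    unfolding map_pmf_comp
  proof (rule map_pmf_cong[OF refl])
    fix RS assume "RS \<in> set_pmf ?noises"
    moreover obtain R S where "RS = (R, S)" by (cases RS)
    ultimately have "RS = (R, S)" "R \<in> {1..T} \<rightarrow> carrier_mat (a div t) (b div s)"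
      "S \<in> {1..T} \<rightarrow> carrier_mat (b div s) (c div d)"
      using set_noise[of R T] set_noise[of S T] by (simp_all only: set_pair_pmf mem_Sigma_iff)
    then show "?U (case RS of (R, S) \<Rightarrow> (shift_noise T Q R, shift_noise T Q' S)) = ?U' RS"
      by (auto simp: upload_def Q(2) Q'(2) intro!: restrict_ext)
  qed
  finally show ?thesis .
qed

lemma T_secure_root_of_unity:
  fixes \<alpha> :: "'a::{field,finite}"
  assumes prim: "primitive_root_of_unity N \<alpha>"
  shows "T_secure t d s T N \<alpha> a b c"
  unfolding T_secure_def
proof (intro allI impI)
  fix P :: "('a mat \<times> 'a mat) pmf" and J
  assume P: "set_pmf P \<subseteq> carrier_mat a b \<times> carrier_mat b c" and J: "J \<subseteq> {1..N}" "card J = T"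
  let ?noises = "pair_pmf (noise T (a div t) (b div s)) (noise T (b div s) (c div d)) ::
    ((nat \<Rightarrow> 'a mat) \<times> (nat \<Rightarrow> 'a mat)) pmf"
  let ?U = "\<lambda>(A, B) (R, S). \<lambda>i\<in>J. upload t d s T \<alpha> A B R S i"
  \<comment> \<open>The zero matrices serve as a fixed reference pair; their upload law is the
    common conditional law.\<close>
  have "map_pmf (?U AB) ?noises = map_pmf (?U (0\<^sub>m a b, 0\<^sub>m b c)) ?noises" if AB: "AB \<in> set_pmf P" for AB
  proof -
    obtain A B where eq: "AB = (A, B)" and A: "A \<in> carrier_mat a b" and B: "B \<in> carrier_mat b c"
      using P AB by blast
    show ?thesis
      unfolding eq prod.case
      by (rule map_pmf_uploads_eq[OF prim A zero_carrier_mat B zero_carrier_mat J])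
  qed
  note mi = mutual_information_pair_pmf_eq_0[where f = ?U and b = 2, OF this]
  have fst: "(\<lambda>((A, B), (R, S)). (A, B)) = (fst :: ('a mat \<times> 'a mat) \<times> (nat \<Rightarrow> 'a mat) \<times> (nat \<Rightarrow> 'a mat) \<Rightarrow> _)"
    by auto
  have uploads: "(\<lambda>((A, B), (R, S)). \<lambda>i\<in>J. upload t d s T \<alpha> A B R S i) = (\<lambda>(AB, RS). ?U AB RS)"
    by auto
  show "prob_space.mutual_information (measure_pmf (pair_pmf P ?noises)) 2
      (count_space UNIV) (count_space UNIV) (\<lambda>((A, B), (R, S)). (A, B))
      (\<lambda>((A, B), (R, S)). \<lambda>i\<in>J. upload t d s T \<alpha> A B R S i) = 0"
    by (rule trans[OF arg_cong2[where f = "prob_space.mutual_information (measure_pmf (pair_pmf P ?noises)) 2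
      (count_space UNIV) (count_space UNIV)", OF fst uploads] mi])
qed

section \<open>Communication rate and conclusion\<close>

lemma communication_rate_eq:
  assumes pos: "t > 0" "d > 0" "s > 0" "a > 0" "c > 0"
    and dvd: "t dvd a" "s dvd b" "d dvd c"
    and A: "A \<in> carrier_mat a b" and B: "B \<in> carrier_mat b c"
    and R: "R \<in> {1..T} \<rightarrow> carrier_mat (a div t) (b div s)"
    and S: "S \<in> {1..T} \<rightarrow> carrier_mat (b div s) (c div d)"
  shows "communication_rate t d s T N \<alpha> A B R S =
    inverse (real N * (real b / (real c * real t * real s)
                     + real b / (real a * real s * real d) + 1 / (real t * real d)))"
proof -
  have "(case upload t d s T \<alpha> A B R S i of (U, V) \<Rightarrow> num_symbols U + num_symbols V)
      + num_symbols (response t d s T \<alpha> A B R S i)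
    = (a div t) * (b div s) + (b div s) * (c div d) + (a div t) * (c div d)" for i
    using upload_carrier[OF A B R S, of \<alpha> i]
    by (auto simp: response_def num_symbols_def split: prod.split)
  then have "communication_rate t d s T N \<alpha> A B R S = real (a * c) /
      (real N * real ((a div t) * (b div s) + (b div s) * (c div d) + (a div t) * (c div d)))"
    using A B by (simp add: communication_rate_def num_symbols_def)
  also have "\<dots> = real a * real c / (real N * (real a / real t * (real b / real s)
      + real b / real s * (real c / real d) + real a / real t * (real c / real d)))"
    using dvd by (simp add: real_of_nat_div)
  \<comment> \<open>Factoring \<open>a * c\<close> out of the cost per server lets it cancel against
    the size of \<open>A * B\<close>.\<close>
  also have "real a / real t * (real b / real s) + real b / real s * (real c / real d)
      + real a / real t * (real c / real d)
    = real a * real c * (real b / (real c * real t * real s)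
        + real b / (real a * real s * real d) + 1 / (real t * real d))"
    using pos by (simp add: field_simps)
  finally show ?thesis
    using pos by (simp add: divide_simps)
qed

theorem theorem1:
  fixes t d s T a b c N :: nat and \<alpha> :: "'a::{field,finite}"
  assumes "t > 0" "d > 0" "s > 0" "T > 0" "a > 0" "b > 0" "c > 0"
    and "t dvd a" "s dvd b" "d dvd c"
    and "N = (if s = 1 then (d + 1) * (t + T) - 1
              else d * s * t + d * T + t * s - 1 + T + 1)"
    and "N dvd CARD('a) - 1"
    and "primitive_root_of_unity N \<alpha>"
  shows "decodable t d s T N \<alpha> a b c \<and>
    T_secure t d s T N \<alpha> a b c \<and>
    (\<forall>A \<in> carrier_mat a b. \<forall>B \<in> carrier_mat b c.
     \<forall>R \<in> {1..T} \<rightarrow> carrier_mat (a div t) (b div s).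
     \<forall>S \<in> {1..T} \<rightarrow> carrier_mat (b div s) (c div d).
       communication_rate t d s T N \<alpha> A B R S =
       inverse (real N * (real b / (real c * real t * real s)
                        + real b / (real a * real s * real d)
                        + 1 / (real t * real d))))"
proof (intro conjI ballI)
  \<comment> \<open>The aliasing bound, with \<open>s\<close> moved to the left to avoid truncated
    subtraction. It is attained for \<open>s = 1\<close>.\<close>
  have "N + s \<ge> (d + 1) * (t * s + T)"
  proof (cases "s = 1")
    case True
    then show ?thesis using assms(11) by simp
  next
    case False
    \<comment> \<open>This keeps the natural-number \<open>- 1\<close> from truncating; it cancels
      with \<open>+ 1\<close>, leaving \<open>N = (d + 1) * (t * s + T)\<close>.\<close>
    have "t * s \<ge> 1" using assms(1,3) by (simp add: Suc_le_eq)
    then show ?thesis using False assms(11) by (simp add: algebra_simps)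
  qed
  then have "int ((d + 1) * (t * s + T)) \<le> int (N + s)" by (simp only: of_nat_le_iff)
  then have N: "int N \<ge> (int d + 1) * (int t * int s + int T) - int s"
    by (simp add: algebra_simps)
  show "decodable t d s T N \<alpha> a b c"
    using assms N of_nat_dvd_card_minus_1_neq_0 by (intro decodable_root_of_unity) blast+
  show "T_secure t d s T N \<alpha> a b c"
    using assms(13) by (rule T_secure_root_of_unity)
qed (rule communication_rate_eq[OF assms(1-3,5,7-10)])

end
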